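(* Idempotent residuated chains are definitionally equivalent to idempotent Galois connections. Explicitly: for every idempotent residuated chain $\mathbf A$, the algebra $\mathbf G(\mathbf A):=(A,\wedge,\vee,{}^\ell,{}^r,1)$ with $x^\ell:=1/x$, $x^r:=x\backslash 1$ is an idempotent Galois connection; for every idempotent Galois connection $\mathbf C$, the algebra $\mathbf R(\mathbf C)$ is an idempotent residuated chain; and $\mathbf R(\mathbf G(\mathbf A))=\mathbf A$ and $\mathbf G(\mathbf R(\mathbf C))=\mathbf C$.
   Context: A residuated lattice is an algebra $(A,\wedge,\vee,\cdot,\backslash,/,1)$ such that $(A,\wedge,\vee)$ is a lattice, $(A,\cdot,1)$ is a monoid, and $y\le x\backslash z \iff x\cdot y\le z\iff x\le z/y$. An idempotent residuated chain is a residuated lattice whose order is total and which satisfies $x\cdot x=x$. An idempotent Galois connection is an algebra $(C,\wedge,\vee,{}^\ell,{}^r,1)$ such that $(C,\wedge,\vee)$ is a totally ordered lattice, $({}^\ell,{}^r)$ is a Galois connection ($x\le y^\ell\iff y\le x^r$ for all $x,y$), $1^\ell=1^r=1$, and for every $x$ there is no element strictly between $x^\ell$ and $x^r$ (i.e. for all $x,y$: $y\le x^\ell\wedge x^r$ or $x^\ell\vee x^r\le y$). For such $\mathbf C$, $\mathbf R(\mathbf C):=(C,\wedge,\vee,\cdot,\backslash,/,1)$ is defined by: $xy=x\wedge y$ if $x\le y^\ell$ and $xy=x\vee y$ if $y^\ell<x$; $x\backslash y=x^r\vee y$ if $x\le y$ and $x\backslash y=x^r\wedge y$ if $y<x$;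 $y/x=x^\ell\vee y$ if $x\le y$ and $y/x=x^\ell\wedge y$ if $y<x$. *)

theory Defs
  imports Main
begin

text \<open>
  Algebras are records of operations on a whole type, so the universe of an algebra is an
  arbitrary nonempty type and equality of algebras is equality of records.
\<close>

record 'a lat_alg =
  meet :: "'a \<Rightarrow> 'a \<Rightarrow> 'a" (infixl "\<sqinter>\<index>" 70)
  join :: "'a \<Rightarrow> 'a \<Rightarrow> 'a" (infixl "\<squnion>\<index>" 65)

definition le :: "('a, 'm) lat_alg_scheme \<Rightarrow> 'a \<Rightarrow> 'a \<Rightarrow> bool" (infix "\<sqsubseteq>\<index>" 50)
  where "x \<sqsubseteq>\<^bsub>A\<^esub> y \<longleftrightarrow> x \<sqinter>\<^bsub>A\<^esub> y = x"

definition lt :: "('a, 'm) lat_alg_scheme \<Rightarrow> 'a \<Rightarrow> 'a \<Rightarrow> bool" (infix "\<sqsubset>\<index>" 50)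
  where "x \<sqsubset>\<^bsub>A\<^esub> y \<longleftrightarrow> x \<sqsubseteq>\<^bsub>A\<^esub> y \<and> x \<noteq> y"

definition is_lattice :: "('a, 'm) lat_alg_scheme \<Rightarrow> bool"
  where "is_lattice A \<longleftrightarrow> class.lattice (meet A) (le A) (lt A) (join A)"

definition totally_ordered :: "('a, 'm) lat_alg_scheme \<Rightarrow> bool"
  where "totally_ordered A \<longleftrightarrow> (\<forall>x y. x \<sqsubseteq>\<^bsub>A\<^esub> y \<or> y \<sqsubseteq>\<^bsub>A\<^esub> x)"

text \<open>
  \<open>ldiv A x y\<close> is the left division of \<open>y\<close> by \<open>x\<close> (x under y), and \<open>rdiv A y x\<close> is \<open>y / x\<close>
  (y over x).
\<close>

record 'a res_alg = "'a lat_alg" +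
  mult :: "'a \<Rightarrow> 'a \<Rightarrow> 'a" (infixl "\<cdot>\<index>" 70)
  ldiv :: "'a \<Rightarrow> 'a \<Rightarrow> 'a"
  rdiv :: "'a \<Rightarrow> 'a \<Rightarrow> 'a"
  res_one :: 'a

record 'a gal_alg = "'a lat_alg" +
  lneg :: "'a \<Rightarrow> 'a"
  rneg :: "'a \<Rightarrow> 'a"
  gal_one :: 'a

definition residuated_lattice :: "'a res_alg \<Rightarrow> bool"
  where "residuated_lattice A \<longleftrightarrow>
    is_lattice A \<and>
    monoid (mult A) (res_one A) \<and>
    (\<forall>x y z. (y \<sqsubseteq>\<^bsub>A\<^esub> ldiv A x z \<longleftrightarrow> x \<cdot>\<^bsub>A\<^esub> y \<sqsubseteq>\<^bsub>A\<^esub> z) \<and>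
             (x \<cdot>\<^bsub>A\<^esub> y \<sqsubseteq>\<^bsub>A\<^esub> z \<longleftrightarrow> x \<sqsubseteq>\<^bsub>A\<^esub> rdiv A z y))"

definition idempotent_residuated_chain :: "'a res_alg \<Rightarrow> bool"
  where "idempotent_residuated_chain A \<longleftrightarrow>
    residuated_lattice A \<and> totally_ordered A \<and> (\<forall>x. x \<cdot>\<^bsub>A\<^esub> x = x)"

definition idempotent_galois_connection :: "'a gal_alg \<Rightarrow> bool"
  where "idempotent_galois_connection C \<longleftrightarrow>
    is_lattice C \<and> totally_ordered C \<and>
    (\<forall>x y. x \<sqsubseteq>\<^bsub>C\<^esub> lneg C y \<longleftrightarrow> y \<sqsubseteq>\<^bsub>C\<^esub> rneg C x) \<and>
    lneg C (gal_one C) = gal_one C \<and> rneg C (gal_one C) = gal_one C \<and>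
    (\<forall>x y. y \<sqsubseteq>\<^bsub>C\<^esub> lneg C x \<sqinter>\<^bsub>C\<^esub> rneg C x \<or> lneg C x \<squnion>\<^bsub>C\<^esub> rneg C x \<sqsubseteq>\<^bsub>C\<^esub> y)"

definition galois_of :: "'a res_alg \<Rightarrow> 'a gal_alg"
  where "galois_of A =
    \<lparr> meet = meet A, join = join A,
      lneg = (\<lambda>x. rdiv A (res_one A) x),
      rneg = (\<lambda>x. ldiv A x (res_one A)),
      gal_one = res_one A \<rparr>"

text \<open>
  In a chain the negation of the first case of each definition below is the strict inequality
  of the second case, so two-way conditionals suffice.
\<close>

definition residuated_of :: "'a gal_alg \<Rightarrow> 'a res_alg"
  where "residuated_of C =
    \<lparr> meet = meet C, join = join C,
      mult = (\<lambda>x y. if x \<sqsubseteq>\<^bsub>C\<^esub> lneg C y then x \<sqinter>\<^bsub>C\<^esub> y else x \<squnion>\<^bsub>C\<^esub> y),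
      ldiv = (\<lambda>x y. if x \<sqsubseteq>\<^bsub>C\<^esub> y then rneg C x \<squnion>\<^bsub>C\<^esub> y else rneg C x \<sqinter>\<^bsub>C\<^esub> y),
      rdiv = (\<lambda>y x. if x \<sqsubseteq>\<^bsub>C\<^esub> y then lneg C x \<squnion>\<^bsub>C\<^esub> y else lneg C x \<sqinter>\<^bsub>C\<^esub> y),
      res_one = gal_one C \<rparr>"

end

theory Submission imports Defs
begin

text \<open>
  In an idempotent residuated chain \<open>x y\<close> is \<open>x \<sqinter> y\<close> if \<open>x y \<le> 1\<close>, and \<open>x \<squnion> y\<close> otherwise, and
  \<open>x y \<le> 1\<close> is equivalent to \<open>x \<le> 1 / y\<close>. Hence the negations determine the multiplication, and
  so, by residuation, the divisions. Conversely, a Galois connection on a chain makes the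
  multiplication of \<open>\<^bold>R(\<^bold>C)\<close> residuated, and the absence of gaps between \<open>x\<^sup>\<ell>\<close> and \<open>x\<^sup>r\<close> amounts
  to its associativity.
\<close>

section \<open>Totally ordered lattices\<close>

locale lattice_chain = lattice inf less_eq less sup
  for inf :: "'a \<Rightarrow> 'a \<Rightarrow> 'a" and less_eq :: "'a \<Rightarrow> 'a \<Rightarrow> bool" (infix "\<preceq>" 50)
    and less :: "'a \<Rightarrow> 'a \<Rightarrow> bool" and sup :: "'a \<Rightarrow> 'a \<Rightarrow> 'a" +
  assumes total: "x \<preceq> y \<or> y \<preceq> x"
begin

sublocale linorder
  by unfold_locales (rule total)

text \<open>Residuation describes a division only through the elements below it; this turns such
  descriptions into equalities.\<close>

lemma eq_if_same_lower_bounds: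
  assumes "\<And>y. y \<preceq> a \<longleftrightarrow> y \<preceq> b"
  shows "a = b"
  using assms by (meson order.antisym order.refl)

end

section \<open>From idempotent Galois connections to idempotent residuated chains\<close>

locale galois_chain = lattice_chain +
  fixes lneg rneg :: "'a \<Rightarrow> 'a" and one :: 'a
  assumes galois: "x \<preceq> lneg y \<longleftrightarrow> y \<preceq> rneg x"
    and lneg_one: "lneg one = one"
    and rneg_one: "rneg one = one"
    and no_gap: "y \<preceq> inf (lneg x) (rneg x) \<or> sup (lneg x) (rneg x) \<preceq> y"
begin

definition mul :: "'a \<Rightarrow> 'a \<Rightarrow> 'a"
  where "mul x y = (if x \<preceq> lneg y then inf x y else sup x y)"

definition under :: "'a \<Rightarrow> 'a \<Rightarrow> 'a"
  where "under x y = (if x \<preceq> y then sup (rneg x) y else inf (rneg x) y)"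

definition over :: "'a \<Rightarrow> 'a \<Rightarrow> 'a"
  where "over y x = (if x \<preceq> y then sup (lneg x) y else inf (lneg x) y)"

lemma le_sup_iff_disj: "x \<preceq> sup y z \<longleftrightarrow> x \<preceq> y \<or> x \<preceq> z"
  by (metis le_supI1 le_supI2 sup.orderE sup.commute total)

lemma inf_le_iff_disj: "inf x y \<preceq> z \<longleftrightarrow> x \<preceq> z \<or> y \<preceq> z"
  by (metis le_infI1 le_infI2 inf.orderE inf.commute total)

text \<open>In a chain, each side says that at least two of \<open>x \<preceq> lneg y\<close>,
  \<open>x \<preceq> z\<close> and \<open>y \<preceq> z\<close> hold. The same count gives
  \<open>le_over_iff\<close>.\<close>

lemma le_under_iff: "y \<preceq> under x z \<longleftrightarrow> mul x y \<preceq> z"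
  by (auto simp: under_def mul_def galois le_sup_iff_disj inf_le_iff_disj)

lemma le_over_iff: "x \<preceq> over z y \<longleftrightarrow> mul x y \<preceq> z"
  by (auto simp: over_def mul_def le_sup_iff_disj inf_le_iff_disj)

text \<open>Since \<open>z\<close> is not below both negations of \<open>y\<close>,
  \<open>no_gap\<close> puts it above both, hence above \<open>x\<close>. This lemma and the next
  order \<open>x\<close> and \<open>z\<close> in the mixed cases of associativity.\<close>

lemma le_if_lneg_rneg:
  assumes "x \<preceq> lneg y" and "\<not> z \<preceq> rneg y"
  shows "x \<preceq> z"
  using assms no_gap[of z y] by (metis le_inf_iff le_sup_iff order.trans)

lemma le_if_rneg_lneg:
  assumes "z \<preceq> rneg y" and "\<not> x \<preceq> lneg y"
  shows "z \<preceq> x"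
  using assms no_gap[of x y] by (metis le_inf_iff le_sup_iff order.trans)

lemma mul_assoc: "mul (mul x y) z = mul x (mul y z)"
proof -
  \<comment> \<open>The cases record whether \<open>mul x y\<close> and \<open>mul y z\<close> are
    meets or joins. By \<open>galois\<close>, \<open>y \<preceq> lneg z\<close> means
    \<open>z \<preceq> rneg y\<close>, so the two preceding lemmas apply when they differ.\<close>
  consider "x \<preceq> lneg y" "y \<preceq> lneg z" | "\<not> x \<preceq> lneg y" "\<not> y \<preceq> lneg z"
    | "x \<preceq> lneg y" "\<not> y \<preceq> lneg z" "x \<preceq> z" | "\<not> x \<preceq> lneg y" "y \<preceq> lneg z" "z \<preceq> x"
    using le_if_lneg_rneg le_if_rneg_lneg galois by blast
  then show ?thesis
  proof cases
    case 1
    \<comment> \<open>The outer products are meets too, because \<open>lneg\<close> is antitone;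
      dually for joins in the next case.\<close>
    then have "inf x y \<preceq> lneg z" and "x \<preceq> lneg (inf y z)"
      using galois by (blast intro: le_infI1 le_infI2)+
    with 1 show ?thesis by (simp add: mul_def inf.assoc)
  next
    case 2
    then have "\<not> sup x y \<preceq> lneg z" and "\<not> x \<preceq> lneg (sup y z)"
      by (metis galois le_sup_iff)+
    with 2 show ?thesis by (simp add: mul_def sup.assoc)
  next
    case outer: 3
    consider "x \<preceq> y" "y \<preceq> z" | "x \<preceq> y" "z \<preceq> y" | "y \<preceq> x" "y \<preceq> z"
      | "y \<preceq> x" "z \<preceq> y"
      using total by blast
    then show ?thesis
    proof cases
      case 1
      with outer show ?thesis
        by (simp add: mul_def inf_absorb1 inf_absorb2 sup_absorb1 sup_absorb2)
    next
      case 2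
      \<comment> \<open>From \<open>z \<preceq> y \<preceq> rneg x\<close>. The sides are
        \<open>mul x z\<close> and \<open>mul x y\<close>, and both equal \<open>x\<close>.\<close>
      then have "x \<preceq> lneg z" using outer galois by (meson order.trans order.antisym)
      with outer 2 show ?thesis
        by (simp add: mul_def inf_absorb1 inf_absorb2 sup_absorb1 sup_absorb2)
    next
      case 3
      \<comment> \<open>Otherwise \<open>y \<preceq> x \<preceq> lneg z\<close>. The sides are
        \<open>mul y z\<close> and \<open>mul x z\<close>, and both equal \<open>z\<close>.\<close>
      then have "\<not> x \<preceq> lneg z" using outer galois by (meson order.trans order.antisym)
      with outer 3 show ?thesis
        by (simp add: mul_def inf_absorb1 inf_absorb2 sup_absorb1 sup_absorb2)
    next
      case 4
      then have "x = y \<and> z = y" using outer galois by (meson order.trans order.antisym)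
      with outer 4 show ?thesis
        by (simp add: mul_def inf_absorb1 inf_absorb2 sup_absorb1 sup_absorb2)
    qed
  next
    case outer: 4
    consider "x \<preceq> y" "y \<preceq> z" | "x \<preceq> y" "z \<preceq> y" | "y \<preceq> x" "y \<preceq> z"
      | "y \<preceq> x" "z \<preceq> y"
      using total by blast
    then show ?thesis
    proof cases
      case 1
      then have "x = y \<and> z = y" using outer galois by (meson order.trans order.antisym)
      with outer 1 show ?thesis
        by (simp add: mul_def inf_absorb1 inf_absorb2 sup_absorb1 sup_absorb2)
    next
      case 2
      then have "x \<preceq> lneg z" using outer galois by (meson order.trans order.antisym)
      with outer 2 show ?thesis
        by (simp add: mul_def inf_absorb1 inf_absorb2 sup_absorb1 sup_absorb2)
    next
      case 3
      then have "\<not> x \<preceq> lneg z" using outer galois by (meson order.trans order.antisym)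
      with outer 3 show ?thesis
        by (simp add: mul_def inf_absorb1 inf_absorb2 sup_absorb1 sup_absorb2)
    next
      case 4
      with outer show ?thesis
        by (simp add: mul_def inf_absorb1 inf_absorb2 sup_absorb1 sup_absorb2)
    qed
  qed
qed

lemma mul_one_left: "mul one x = x"
  by (auto simp: mul_def galois rneg_one inf_absorb2 sup_absorb2)

lemma mul_one_right: "mul x one = x"
  by (auto simp: mul_def lneg_one inf_absorb1 sup_absorb1)

lemma mul_self: "mul x x = x"
  by (simp add: mul_def)

text \<open>By \<open>galois\<close> and \<open>rneg_one\<close>, \<open>x \<preceq> one\<close> iff
  \<open>one \<preceq> lneg x\<close>, so in either branch \<open>one\<close> is absorbed.\<close>

lemma over_one: "over one x = lneg x"
  using galois[of one x] by (auto simp: over_def rneg_one sup_absorb1 inf_absorb1)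

lemma under_one: "under x one = rneg x"
  using galois[of x one] by (auto simp: under_def lneg_one sup_absorb1 inf_absorb1)

end

section \<open>From idempotent residuated chains to idempotent Galois connections\<close>

locale idempotent_chain = lattice_chain +
  fixes mul under over :: "'a \<Rightarrow> 'a \<Rightarrow> 'a" and one :: 'a
  assumes assoc: "mul (mul x y) z = mul x (mul y z)"
    and one_left: "mul one x = x"
    and one_right: "mul x one = x"
    and le_under_iff: "y \<preceq> under x z \<longleftrightarrow> mul x y \<preceq> z"
    and le_over_iff: "x \<preceq> over z y \<longleftrightarrow> mul x y \<preceq> z"
    and idem: "mul x x = x"
begin

lemma mul_mono:
  assumes "x \<preceq> x'" and "y \<preceq> y'"
  shows "mul x y \<preceq> mul x' y'"
proof -
  have "mul x y \<preceq> mul x' y"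
    by (meson assms(1) le_over_iff order.refl order.trans)
  also have "\<dots> \<preceq> mul x' y'"
    by (meson assms(2) le_under_iff order.refl order.trans)
  finally show ?thesis .
qed

text \<open>Multiplying \<open>mul x y \<preceq> one\<close> by \<open>x\<close> on the left or
  \<open>y\<close> on the right leaves \<open>mul x y\<close> fixed by idempotence, which bounds it
  by both factors. Conversely, \<open>inf x y\<close> is its own square. The join case is
  dual.\<close>

lemma mul_eq_inf:
  assumes "mul x y \<preceq> one"
  shows "mul x y = inf x y"
proof (rule order.antisym)
  have "mul x y \<preceq> x"
    using mul_mono[OF order.refl[of x] assms] by (simp add: assoc[symmetric] idem one_right)
  moreover have "mul x y \<preceq> y"
    using mul_mono[OF assms order.refl[of y]] by (simp add: assoc idem one_left)
  ultimately show "mul x y \<preceq> inf x y" by simp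
  show "inf x y \<preceq> mul x y"
    using mul_mono[of "inf x y" x "inf x y" y] by (simp add: idem)
qed

lemma mul_eq_sup:
  assumes "\<not> mul x y \<preceq> one"
  shows "mul x y = sup x y"
proof (rule order.antisym)
  have le: "one \<preceq> mul x y" using assms total by blast
  have "x \<preceq> mul x y"
    using mul_mono[OF order.refl[of x] le] by (simp add: assoc[symmetric] idem one_right)
  moreover have "y \<preceq> mul x y"
    using mul_mono[OF le order.refl[of y]] by (simp add: assoc idem one_left)
  ultimately show "sup x y \<preceq> mul x y" by simp
  show "mul x y \<preceq> sup x y"
    using mul_mono[of x "sup x y" y "sup x y"] by (simp add: idem)
qed

lemma mul_eq: "mul x y = (if x \<preceq> over one y then inf x y else sup x y)"
  using mul_eq_inf[of x y] mul_eq_sup[of x y] by (auto simp: le_over_iff)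

text \<open>
  Evaluate \<open>y x r\<close> in two ways. If \<open>x \<preceq> y\<close> then \<open>(y x) r = y r = r\<close> and \<open>y (x r) = y x = y\<close>;
  if \<open>y \<preceq> x\<close> then \<open>(y x) r = x r = r\<close> and \<open>y (x r) = y r = y\<close>.
\<close>

lemma eq_if_mul_le_one:
  assumes "mul x r \<preceq> one" and "y \<preceq> r" and "\<not> mul y x \<preceq> one"
  shows "y = r"
proof -
  have yx: "mul y x = sup y x" by (rule mul_eq_sup[OF assms(3)])
  have xr: "mul x r = inf x r" by (rule mul_eq_inf[OF assms(1)])
  have assoc': "mul (mul y x) r = mul y (mul x r)" by (rule assoc)
  show ?thesis
  proof (cases "x \<preceq> y")
    case True
    then have y: "mul y x = y" "mul x r = x"
      using yx xr sup_absorb1 inf_absorb1 order.trans[OF True assms(2)] by simp_all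
    \<comment> \<open>\<open>y = mul y y \<preceq> mul y r\<close>, while \<open>y = mul y x\<close>
      is not below \<open>one\<close>.\<close>
    then have "\<not> mul y r \<preceq> one"
      using assms(2,3) mul_mono[of y y y r] idem order.trans order.refl by metis
    then have "mul y r = r"
      using mul_eq_sup assms(2) sup_absorb2 by metis
    with assoc' y show ?thesis by simp
  next
    case False
    then have x: "y \<preceq> x" "mul y x = x" using total yx sup_absorb2 by auto
    have "\<not> x \<preceq> r"
      using x assms(1,3) xr by (auto simp: inf_absorb1)
    then have r: "mul x r = r" using total xr inf_absorb2 by metis
    have "mul y r \<preceq> one"
      using mul_mono[of y r r r] assms(1,2) r idem order.trans order.refl by metis
    then have "mul y r = y"
      using mul_eq_inf assms(2) inf_absorb1 by metis
    with assoc' x r show ?thesis by simp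
  qed
qed

text \<open>Reversing the multiplication swaps the divisions, so \<open>eq_if_mul_le_one\<close>
  also holds in mirrored form.\<close>

interpretation opposite: idempotent_chain inf less_eq less sup
  "\<lambda>x y. mul y x" "\<lambda>x y. over y x" "\<lambda>y x. under x y" one
  by unfold_locales (simp_all add: assoc one_left one_right le_under_iff le_over_iff idem)

lemma le_or_ge_negations:
  "y \<preceq> inf (over one x) (under x one) \<or> sup (over one x) (under x one) \<preceq> y"
proof -
  let ?l = "over one x" and ?r = "under x one"
  \<comment> \<open>If \<open>y \<preceq> ?l\<close>, the mirrored lemma forces
    \<open>y = ?l\<close>; its bound is instantiated first because the product is reversed.\<close>
  have "?l \<preceq> y" if "\<not> y \<preceq> ?r"
    using that opposite.eq_if_mul_le_one[of ?l x y] total[of y ?l]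
    by (auto simp: le_under_iff simp flip: le_over_iff)
  moreover have "?r \<preceq> y" if "\<not> y \<preceq> ?l"
    using that eq_if_mul_le_one[of x ?r y] total[of y ?r]
    by (auto simp: le_over_iff simp flip: le_under_iff)
  ultimately show ?thesis
    using total by auto
qed

sublocale galois: galois_chain inf less_eq less sup "\<lambda>x. over one x" "\<lambda>x. under x one" one
proof unfold_locales
  show "x \<preceq> over one y \<longleftrightarrow> y \<preceq> under x one" for x y
    by (simp add: le_over_iff le_under_iff)
  show "over one one = one"
    by (rule eq_if_same_lower_bounds) (simp add: le_over_iff one_right)
  show "under one one = one"
    by (rule eq_if_same_lower_bounds) (simp add: le_under_iff one_left)
qed (rule le_or_ge_negations)

lemma galois_mul: "galois.mul x y = mul x y"
  by (simp add: galois.mul_def mul_eq)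

text \<open>Both are residuals of the same multiplication, by \<open>galois_mul\<close>.\<close>

lemma galois_under: "galois.under x y = under x y"
  by (rule eq_if_same_lower_bounds) (simp add: galois.le_under_iff le_under_iff galois_mul)

lemma galois_over: "galois.over x y = over x y"
  by (rule eq_if_same_lower_bounds) (simp add: galois.le_over_iff le_over_iff galois_mul)

end

section \<open>Transfer to the record algebras\<close>

lemma idempotent_residuated_chain_iff:
  "idempotent_residuated_chain A \<longleftrightarrow>
    idempotent_chain (meet A) (le A) (lt A) (join A) (mult A) (ldiv A) (rdiv A) (res_one A)"
  unfolding idempotent_residuated_chain_def residuated_lattice_def is_lattice_def
    totally_ordered_def idempotent_chain_def idempotent_chain_axioms_def lattice_chain_def
    lattice_chain_axioms_def monoid_def monoid_axioms_def semigroup_def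
  by blast

lemma idempotent_galois_connection_iff:
  "idempotent_galois_connection C \<longleftrightarrow>
    galois_chain (meet C) (le C) (lt C) (join C) (lneg C) (rneg C) (gal_one C)"
  unfolding idempotent_galois_connection_def is_lattice_def
    totally_ordered_def galois_chain_def galois_chain_axioms_def lattice_chain_def
    lattice_chain_axioms_def
  by blast

lemma galois_of_simps [simp]:
  "meet (galois_of A) = meet A" "join (galois_of A) = join A"
  "le (galois_of A) = le A" "lt (galois_of A) = lt A"
  "lneg (galois_of A) = (\<lambda>x. rdiv A (res_one A) x)"
  "rneg (galois_of A) = (\<lambda>x. ldiv A x (res_one A))"
  "gal_one (galois_of A) = res_one A"
  by (simp_all add: galois_of_def fun_eq_iff le_def lt_def)

lemma residuated_of_simps [simp]:
  "meet (residuated_of C) = meet C" "join (residuated_of C) = join C"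
  "le (residuated_of C) = le C" "lt (residuated_of C) = lt C"
  "res_one (residuated_of C) = gal_one C"
  by (simp_all add: residuated_of_def fun_eq_iff le_def lt_def)

text \<open>The assumption is the locale predicate under which the exported equations such as
  \<open>galois_chain.mul_def\<close> hold.\<close>

lemma residuated_of_operations:
  assumes "galois_chain (meet C) (le C) (lt C) (join C) (lneg C) (rneg C) (gal_one C)"
  shows "mult (residuated_of C) = galois_chain.mul (meet C) (le C) (join C) (lneg C)"
    and "ldiv (residuated_of C) = galois_chain.under (meet C) (le C) (join C) (rneg C)"
    and "rdiv (residuated_of C) = galois_chain.over (meet C) (le C) (join C) (lneg C)"
  using assms
  by (simp_all add: residuated_of_def fun_eq_iff galois_chain.mul_def galois_chain.under_def
      galois_chain.over_def)

lemma idempotent_galois_connection_galois_of: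
  assumes "idempotent_residuated_chain A"
  shows "idempotent_galois_connection (galois_of A)"
proof -
  interpret idempotent_chain "meet A" "le A" "lt A" "join A" "mult A" "ldiv A" "rdiv A" "res_one A"
    using assms by (simp add: idempotent_residuated_chain_iff)
  show ?thesis
    unfolding idempotent_galois_connection_iff using galois.galois_chain_axioms by simp
qed

lemma idempotent_residuated_chain_residuated_of:
  assumes "idempotent_galois_connection C"
  shows "idempotent_residuated_chain (residuated_of C)"
proof -
  interpret galois_chain "meet C" "le C" "lt C" "join C" "lneg C" "rneg C" "gal_one C"
    using assms by (simp add: idempotent_galois_connection_iff)
  have "idempotent_chain (meet C) (le C) (lt C) (join C) mul under over (gal_one C)"
    by unfold_locales
      (simp_all add: mul_assoc mul_one_left mul_one_right le_under_iff le_over_iff mul_self)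
  then show ?thesis
    by (simp add: idempotent_residuated_chain_iff residuated_of_operations galois_chain_axioms)
qed

lemma residuated_of_galois_of:
  assumes "idempotent_residuated_chain A"
  shows "residuated_of (galois_of A) = A"
proof -
  interpret idempotent_chain "meet A" "le A" "lt A" "join A" "mult A" "ldiv A" "rdiv A" "res_one A"
    using assms by (simp add: idempotent_residuated_chain_iff)
  show ?thesis
    \<comment> \<open>The operations become those of the sublocale \<open>galois\<close>, already
      identified with the operations of \<open>A\<close>.\<close>
    by (rule res_alg.equality)
      (simp_all add: residuated_of_operations galois.galois_chain_axioms fun_eq_iff
        galois_mul galois_under galois_over)
qed

lemma galois_of_residuated_of:
  assumes "idempotent_galois_connection C"
  shows "galois_of (residuated_of C) = C"
proof -
  interpret galois_chain "meet C" "le C" "lt C" "join C" "lneg C" "rneg C" "gal_one C"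
    using assms by (simp add: idempotent_galois_connection_iff)
  show ?thesis
    by (rule gal_alg.equality)
      (simp_all add: residuated_of_operations galois_chain_axioms fun_eq_iff over_one under_one)
qed

theorem corollary4p3:
  shows "(\<forall>A :: 'a res_alg. idempotent_residuated_chain A \<longrightarrow>
            idempotent_galois_connection (galois_of A)) \<and>
         (\<forall>C :: 'a gal_alg. idempotent_galois_connection C \<longrightarrow>
            idempotent_residuated_chain (residuated_of C)) \<and>
         (\<forall>A :: 'a res_alg. idempotent_residuated_chain A \<longrightarrow>
            residuated_of (galois_of A) = A) \<and>
         (\<forall>C :: 'a gal_alg. idempotent_galois_connection C \<longrightarrow>
            galois_of (residuated_of C) = C)"
  by (simp add: idempotent_galois_connection_galois_of idempotent_residuated_chain_residuated_of
      residuated_of_galois_of galois_of_residuated_of)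

end
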